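(* Let $T>0$, $I=(0,1)$, let $G\subset[0,T]\times I$ be measurable, and let $G_{\mathrm{ref}}=\{(t,s)\in[0,T]\times\mathbb T_2:(t,\pi(s))\in G\}$ be its reflected periodization, where $\mathbb T_2=\mathbb R/(2\mathbb Z)$ and $\pi(s)=s$ for $0\le s\le1$, $\pi(s)=2-s$ for $1<s<2$. Then $G_{\mathrm{ref}}$ satisfies (OSC-T) on $[0,T]\times\mathbb T_2$ if and only if $G$ satisfies both (OSC-D) and (OSC-N).
   Context: Labelled double cover. $\widetilde I=I\times\{\xi,\eta\}$ with the natural Lebesgue measure $|\cdot|$, so $|\widetilde I|=2$. Its points are written $[x;\sigma]$, $x\in I$, $\sigma\in\{\xi,\eta\}$. Characteristics on the interval. $L_{[x;\xi]}$ (resp. $L_{[x;\eta]}$) is the characteristic line in $\{t\ge0\}$ starting from $(t,x)=(0,x)$ and moving initially to the right (resp. left) with unit speed, reflecting at the boundary points $x=0$ and $x=1$. Explicitly, extending $\pi$ $2$-periodically, $L_{[x;\xi]}=\{(s,\pi(x+s)):s\ge0\}$ and $L_{[x;\eta]}=\{(s,\pi(x-s)):s\ge0\}$. Intersection sets. For $\widetilde A\subset\widetilde I$, $$\mathcal M_{\widetilde A}=\{(t,x)\in[0,\infty)\times I:\ \exists\text{ distinct }\widetilde y,\widetilde z\in\widetilde A\text{ with }(t,x)\in L_{\widetilde y}\cap L_{\widetilde z}\},\qquad \mathcal M_{\widetilde A}(\tau)=\mathcal M_{\widetilde A}\cap\{t\le\tau\}.$$ For disjoint $\widetilde E,\widetilde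 F\subset\widetilde I$, $$\mathcal W_{\widetilde E,\widetilde F}=\{(t,x)\in[0,\infty)\times I:\ \exists\,\widetilde y\in\widetilde E,\ \widetilde z\in\widetilde F,\ \widetilde y\ne\widetilde z,\text{ with }(t,x)\in L_{\widetilde y}\cap L_{\widetilde z}\},\qquad \mathcal W_{\widetilde E,\widetilde F}(\tau)=\mathcal W_{\widetilde E,\widetilde F}\cap\{t\le\tau\}.$$ (OSC-D). For measurable $\widetilde A\subset\widetilde I$, $G$ is $(\widetilde A;T)$-observable symmetric if $G\setminus(\mathcal M_{\widetilde A}(T)\cup\mathcal M_{\widetilde I\setminus\widetilde A}(T))$ has two-dimensional Lebesgue measure $0$. $\widetilde A$ is trivial if $|\widetilde A|=0$ or $|\widetilde A|=2$, and nontrivial otherwise. $G$ satisfies (OSC-D) if for every nontrivial measurable $\widetilde A\subset\widetilde I$, $G$ is not $(\widetilde A;T)$-observable symmetric. (OSC-N). For disjoint measurable $\widetilde E,\widetilde F\subset\widetilde I$, $G$ is $(\widetilde E,\widetilde F;T)$-observable symmetric if $G\setminus(\mathcal W_{\widetilde E,\widetilde F}(T)\cup\mathcal M_{\widetilde I\setminus(\widetilde E\cup\widetilde F)}(T))$ has two-dimensional Lebesgue measure $0$. The pair $(\widetilde E,\widetilde F)$ is trivial if $|\widetilde E|=0$ or $|\widetilde F|=0$, and nontrivial otherwise. $G$ satisfies (OSC-N) if for every nontrivial pair of disjoint measurable sets $(\widetilde E,\widetilde F)$, $G$ is not $(\widetilde E,\widetilde F;T)$-observable symmetric. (OSC-T)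 on the torus $\mathbb T_2$ of length $2$. On $[0,T]\times\mathbb T_2$ use the characteristic coordinates $\xi=x+t$, $\eta=x-t$ modulo $2$. For measurable $A,B\subset\mathbb T_2$ let $L_{\xi\in A}=\{(t,x):x+t\in A\}$ and $L_{\eta\in B}=\{(t,x):x-t\in B\}$. A measurable set $H\subset[0,T]\times\mathbb T_2$ is $(A,B)$-observable symmetric if the symmetric difference $[H\cap L_{\xi\in A}]\,\Delta\,[H\cap L_{\eta\in B}]$ has two-dimensional Lebesgue measure $0$. The pair $(A,B)$ is trivial if $|A|=|B|=0$ or $|A|=|B|=2$, and nontrivial otherwise. $H$ satisfies (OSC-T) if for every nontrivial pair $(A,B)$ of measurable sets, $H$ is not $(A,B)$-observable symmetric. *)

theory Defs
  imports "HOL-Analysis.Analysis" "HOL-Library.Real_Mod"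
begin

text \<open>
  Space-time points are pairs \<open>(t, x)\<close>. All measurability is Lebesgue measurability, and
  two-dimensional null sets are null sets of \<^term>\<open>lebesgue :: (real \<times> real) measure\<close>.
\<close>

abbreviation unit_intvl :: "real set" where
  "unit_intvl \<equiv> {0<..<1}"

text \<open>
  The torus of length 2 is the fundamental domain \<open>[0,2)\<close> with arithmetic modulo 2
  (\<open>x rmod 2\<close> is the representative of \<open>x\<close>) and with the restricted Lebesgue measure.
\<close>

definition torus2 :: "real set" where
  "torus2 = {0..<2}"

definition fold_map :: "real \<Rightarrow> real" where
  "fold_map s = (if s rmod 2 \<le> 1 then s rmod 2 else 2 - s rmod 2)"

datatype direction = Xi | Eta

type_synonym labelled_point = "real \<times> direction"

text \<open>
  The measurable sets of the product are exactly the sets both of whose slices are Lebesgue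
  measurable subsets of the interval, and the measure is the sum of the measures of the slices
  (see below).
\<close>

definition double_cover :: "labelled_point measure" where
  "double_cover = lebesgue_on unit_intvl \<Otimes>\<^sub>M count_space UNIV"

fun char_line :: "labelled_point \<Rightarrow> (real \<times> real) set" where
  "char_line (x, Xi) = {(s, fold_map (x + s)) | s. s \<ge> 0}"
| "char_line (x, Eta) = {(s, fold_map (x - s)) | s. s \<ge> 0}"

definition self_meet :: "labelled_point set \<Rightarrow> (real \<times> real) set" where
  "self_meet A = {p \<in> {0..} \<times> unit_intvl.
     \<exists>y\<in>A. \<exists>z\<in>A. y \<noteq> z \<and> p \<in> char_line y \<inter> char_line z}"

definition cross_meet :: "labelled_point set \<Rightarrow> labelled_point set \<Rightarrow> (real \<times> real) set" where
  "cross_meet E F = {p \<in> {0..} \<times> unit_intvl.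
     \<exists>y\<in>E. \<exists>z\<in>F. y \<noteq> z \<and> p \<in> char_line y \<inter> char_line z}"

definition up_to_time :: "real \<Rightarrow> (real \<times> real) set \<Rightarrow> (real \<times> real) set" where
  "up_to_time \<tau> S = S \<inter> {(t, x). t \<le> \<tau>}"

definition obs_sym_D :: "real \<Rightarrow> labelled_point set \<Rightarrow> (real \<times> real) set \<Rightarrow> bool" where
  "obs_sym_D T A G \<longleftrightarrow>
     G - (up_to_time T (self_meet A) \<union> up_to_time T (self_meet (space double_cover - A)))
       \<in> null_sets lebesgue"

definition trivial_D :: "labelled_point set \<Rightarrow> bool" where
  "trivial_D A \<longleftrightarrow> emeasure double_cover A = 0 \<or> emeasure double_cover A = 2"

definition OSC_D :: "real \<Rightarrow> (real \<times> real) set \<Rightarrow> bool" where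
  "OSC_D T G \<longleftrightarrow>
     (\<forall>A \<in> sets double_cover. \<not> trivial_D A \<longrightarrow> \<not> obs_sym_D T A G)"

definition obs_sym_N ::
  "real \<Rightarrow> labelled_point set \<Rightarrow> labelled_point set \<Rightarrow> (real \<times> real) set \<Rightarrow> bool" where
  "obs_sym_N T E F G \<longleftrightarrow>
     G - (up_to_time T (cross_meet E F) \<union>
          up_to_time T (self_meet (space double_cover - (E \<union> F))))
       \<in> null_sets lebesgue"

definition trivial_N :: "labelled_point set \<Rightarrow> labelled_point set \<Rightarrow> bool" where
  "trivial_N E F \<longleftrightarrow> emeasure double_cover E = 0 \<or> emeasure double_cover F = 0"

definition OSC_N :: "real \<Rightarrow> (real \<times> real) set \<Rightarrow> bool" where
  "OSC_N T G \<longleftrightarrow>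
     (\<forall>E \<in> sets double_cover. \<forall>F \<in> sets double_cover.
        E \<inter> F = {} \<longrightarrow> \<not> trivial_N E F \<longrightarrow> \<not> obs_sym_N T E F G)"

definition strip_xi :: "real \<Rightarrow> real set \<Rightarrow> (real \<times> real) set" where
  "strip_xi T A = {(t, x) \<in> {0..T} \<times> torus2. (x + t) rmod 2 \<in> A}"

definition strip_eta :: "real \<Rightarrow> real set \<Rightarrow> (real \<times> real) set" where
  "strip_eta T B = {(t, x) \<in> {0..T} \<times> torus2. (x - t) rmod 2 \<in> B}"

definition obs_sym_T :: "real \<Rightarrow> real set \<Rightarrow> real set \<Rightarrow> (real \<times> real) set \<Rightarrow> bool" where
  "obs_sym_T T A B H \<longleftrightarrow>
     sym_diff (H \<inter> strip_xi T A) (H \<inter> strip_eta T B) \<in> null_sets lebesgue"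

definition trivial_T :: "real set \<Rightarrow> real set \<Rightarrow> bool" where
  "trivial_T A B \<longleftrightarrow>
     (emeasure lebesgue A = 0 \<and> emeasure lebesgue B = 0) \<or>
     (emeasure lebesgue A = 2 \<and> emeasure lebesgue B = 2)"

definition OSC_T :: "real \<Rightarrow> (real \<times> real) set \<Rightarrow> bool" where
  "OSC_T T H \<longleftrightarrow>
     (\<forall>A \<in> sets (lebesgue_on torus2). \<forall>B \<in> sets (lebesgue_on torus2).
        \<not> trivial_T A B \<longrightarrow> \<not> obs_sym_T T A B H)"

definition reflected :: "real \<Rightarrow> (real \<times> real) set \<Rightarrow> (real \<times> real) set" where
  "reflected T G = {(t, s) \<in> {0..T} \<times> torus2. (t, fold_map s) \<in> G}"

lemma fold_map_base:
  assumes "0 \<le> s" "s < 2"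
  shows "fold_map s = (if s \<le> 1 then s else 2 - s)"
  using assms by (simp add: fold_map_def rmod_idem)

lemma sets_double_cover_iff:
  "A \<in> sets double_cover \<longleftrightarrow>
     (\<forall>d. {x. (x, d) \<in> A} \<subseteq> unit_intvl \<and> {x. (x, d) \<in> A} \<in> sets lebesgue)"
proof
  assume A: "A \<in> sets double_cover"
  show "\<forall>d. {x. (x, d) \<in> A} \<subseteq> unit_intvl \<and> {x. (x, d) \<in> A} \<in> sets lebesgue"
  proof
    fix d
    have "(\<lambda>x. (x, d)) -` A \<in> sets (lebesgue_on unit_intvl)"
      using A unfolding double_cover_def by (rule sets_Pair2)
    then show "{x. (x, d) \<in> A} \<subseteq> unit_intvl \<and> {x. (x, d) \<in> A} \<in> sets lebesgue"
      by (simp add: sets_restrict_space_iff vimage_def)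
  qed
next
  assume *: "\<forall>d. {x. (x, d) \<in> A} \<subseteq> unit_intvl \<and> {x. (x, d) \<in> A} \<in> sets lebesgue"
  have "A = {x. (x, Xi) \<in> A} \<times> {Xi} \<union> {x. (x, Eta) \<in> A} \<times> {Eta}"
    by (auto; metis direction.exhaust)
  moreover have "{x. (x, d) \<in> A} \<times> {d} \<in> sets double_cover" for d
    unfolding double_cover_def using *
    by (intro pair_measureI) (auto simp: sets_restrict_space_iff)
  ultimately show "A \<in> sets double_cover"
    by (metis sets.Un)
qed

lemma emeasure_double_cover:
  assumes "A \<in> sets double_cover"
  shows "emeasure double_cover A =
    emeasure lebesgue {x. (x, Xi) \<in> A} + emeasure lebesgue {x. (x, Eta) \<in> A}"
proof -
  have U: "(UNIV :: direction set) = {Xi, Eta}"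
    using direction.exhaust by auto
  interpret C: finite_measure "count_space (UNIV :: direction set)"
    by (rule finite_measure_count_space) (simp add: U)
  have sl: "{x. (x, d) \<in> A} \<subseteq> unit_intvl" "{x. (x, d) \<in> A} \<in> sets lebesgue" for d
    using assms by (auto simp: sets_double_cover_iff)
  have A: "A = {x. (x, Xi) \<in> A} \<times> {Xi} \<union> {x. (x, Eta) \<in> A} \<times> {Eta}"
    by (auto; metis direction.exhaust)
  have m: "{x. (x, d) \<in> A} \<times> {d} \<in> sets double_cover" for d
    unfolding double_cover_def using sl
    by (intro pair_measureI) (auto simp: sets_restrict_space_iff)
  have e: "emeasure double_cover ({x. (x, d) \<in> A} \<times> {d}) = emeasure lebesgue {x. (x, d) \<in> A}" for d
    unfolding double_cover_def using sl
    by (subst C.emeasure_pair_measure_Times)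
       (auto simp: sets_restrict_space_iff emeasure_restrict_space)
  have "emeasure double_cover ({x. (x, Xi) \<in> A} \<times> {Xi} \<union> {x. (x, Eta) \<in> A} \<times> {Eta}) =
    emeasure double_cover ({x. (x, Xi) \<in> A} \<times> {Xi}) +
    emeasure double_cover ({x. (x, Eta) \<in> A} \<times> {Eta})"
    by (rule plus_emeasure[symmetric]) (auto intro: m)
  then show ?thesis
    using A e by simp
qed

lemma emeasure_space_double_cover: "emeasure double_cover (space double_cover) = 2"
proof -
  have "space double_cover = unit_intvl \<times> UNIV"
    by (simp add: double_cover_def space_pair_measure)
  moreover have "unit_intvl \<times> (UNIV :: direction set) \<in> sets double_cover"
    by (simp add: sets_double_cover_iff greaterThanLessThan_def lessThan_def greaterThan_def Int_def)
  moreover have "{x. (x, d) \<in> unit_intvl \<times> (UNIV :: direction set)} = unit_intvl" for d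
    by auto
  ultimately show ?thesis
    by (simp add: emeasure_double_cover)
qed

end

theory Submission
  imports Defs
begin

text \<open>
  Unfolding the reflections identifies the double cover, up to a null set, with the torus:
  \<open>[a; \<xi>]\<close> corresponds to \<open>a\<close> and \<open>[z; \<eta>]\<close> to \<open>2 - z\<close>. Almost every \<open>(t, x)\<close> in the strip lies on
  exactly two characteristics, those of the torus points \<open>x - t\<close> and \<open>- x - t\<close>. Call \<open>(A, B)\<close>
  swap symmetric on \<open>G\<close> if almost everywhere on \<open>G\<close> either foot lies in \<open>A\<close> iff the other lies
  in \<open>B\<close>. Then (OSC-D) speaks about the pairs \<open>(A, A)\<close>, (OSC-N) about disjoint pairs, and (OSC-T),
  after replacing \<open>A\<close> by \<open>- A\<close>, about all pairs. A swap symmetric pair \<open>(A, B)\<close> yields the disjoint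
  swap symmetric pair \<open>(A - B, B - A)\<close>. If one of these differences is null, then \<open>(A, A)\<close> and
  \<open>(B, B)\<close> are swap symmetric, so under (OSC-D) each of \<open>A\<close>, \<open>B\<close> is null or full. They cannot be of
  opposite kinds, since \<open>G\<close> would then be null and (OSC-D) would fail.
\<close>

section \<open>Feet of characteristics and swap symmetry: the vocabulary\<close>

text \<open>On the torus every point \<open>a\<close> moves to \<open>a + t\<close>. For
  \<open>c = 1\<close> and \<open>c = -1\<close> this is the starting point that reaches
  \<open>x\<close>, respectively \<open>- x\<close>, at time \<open>t\<close>; both positions fold
  to \<open>x\<close>.\<close>

definition foot :: "real \<Rightarrow> real \<times> real \<Rightarrow> real" where
  "foot c p = (c * snd p - fst p) rmod 2"

text \<open>The torus without 0 and 1, the ends of the interval, which carry no labelled point;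
  \<open>label\<close> is then a bijection onto the double cover.\<close>

definition cover :: "real set" where
  "cover = {0<..<2} - {1}"

definition label :: "real \<Rightarrow> labelled_point" where
  "label a = (if a < 1 then (a, Xi) else (2 - a, Eta))"

text \<open>The exceptional null set: off it both feet lie in \<open>cover\<close>.\<close>

definition corners :: "(real \<times> real) set" where
  "corners = {p. foot 1 p \<in> {0, 1} \<or> foot (-1) p \<in> {0, 1}}"

definition swap_sym :: "(real \<times> real) set \<Rightarrow> real set \<Rightarrow> real set \<Rightarrow> bool" where
  "swap_sym G A B \<longleftrightarrow> negligible {p \<in> G. (foot 1 p \<in> A) \<noteq> (foot (-1) p \<in> B) \<or>
                                        (foot (-1) p \<in> A) \<noteq> (foot 1 p \<in> B)}"

text \<open>Used with \<open>N = corners\<close>, so that identities between exceptional sets need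
  checking only where both feet are in \<open>cover\<close>.\<close>

lemma negligible_cong_mod:
  assumes "negligible N" "X - N \<subseteq> Y" "Y - N \<subseteq> X"
  shows "negligible X \<longleftrightarrow> negligible Y"
proof -
  have "X \<subseteq> Y \<union> N" "Y \<subseteq> X \<union> N"
    using assms by auto
  with assms(1) show ?thesis
    by (meson negligible_Un negligible_subset)
qed

subsection \<open>Arithmetic modulo 2\<close>

lemma rmod2_bounds: "0 \<le> x rmod 2" "x rmod 2 < 2"
  using rmod_nonneg[of 2 x] rmod_less[of 2 x] by auto

lemma rmod2_eq_iff: "0 \<le> z \<Longrightarrow> z < 2 \<Longrightarrow> x rmod 2 = z \<longleftrightarrow> (\<exists>n. x = z + 2 * of_int n)"
  using rmod_unique[of z 2 x] by (auto simp: rmod_def mult.commute intro: exI[of _ "\<lfloor>x / 2\<rfloor>"])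

lemma rmod2_decompose: "\<exists>n. x = x rmod 2 + 2 * of_int n"
  using rmod2_eq_iff[of "x rmod 2" x] rmod2_bounds[of x] by auto

text \<open>Multiples of 2 are excluded because there the representative of \<open>- x\<close> is 0,
  not 2.\<close>

lemma rmod2_uminus:
  assumes "x rmod 2 \<noteq> 0"
  shows "(- x) rmod 2 = 2 - x rmod 2"
proof -
  obtain n where n: "x = x rmod 2 + 2 * of_int n"
    using rmod2_decompose by blast
  then have "- x = (2 - x rmod 2) + 2 * of_int (- n - 1)"
    by simp
  moreover have "0 \<le> 2 - x rmod 2" "2 - x rmod 2 < 2"
    using rmod2_bounds[of x] assms by linarith+
  ultimately show ?thesis
    using rmod2_eq_iff by blast
qed

lemma rmod2_add_2: "(x + 2) rmod 2 = x rmod 2" "(2 + x) rmod 2 = x rmod 2" "(2 - x) rmod 2 = (- x) rmod 2"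
  using rmod_add[of x 2 2] rmod_add[of 2 2 x] rmod_diff[of 2 2 x] rmod_diff[of 0 2 x] by simp_all

text \<open>Translation on the torus is invertible; this turns a position at time \<open>t\<close>
  into a foot.\<close>

lemma rmod2_add_eq_iff:
  assumes "0 \<le> a" "a < 2" "0 \<le> x" "x < 2"
  shows "(a + t) rmod 2 = x \<longleftrightarrow> a = (x - t) rmod 2"
proof -
  have "(\<exists>n. a + t = x + 2 * of_int n) \<longleftrightarrow> (\<exists>n. x - t = a + 2 * of_int n)"
  proof
    assume "\<exists>n. a + t = x + 2 * of_int n"
    then obtain n where "a + t = x + 2 * of_int n" ..
    then have "x - t = a + 2 * of_int (- n)"
      by simp
    then show "\<exists>n. x - t = a + 2 * of_int n" ..
  next
    assume "\<exists>n. x - t = a + 2 * of_int n"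
    then obtain n where "x - t = a + 2 * of_int n" ..
    then have "a + t = x + 2 * of_int (- n)"
      by simp
    then show "\<exists>n. a + t = x + 2 * of_int n" ..
  qed
  then show ?thesis
    using assms rmod2_eq_iff by metis
qed

lemma fold_map_eq_iff:
  assumes "0 < x" "x < 1"
  shows "fold_map u = x \<longleftrightarrow> u rmod 2 = x \<or> u rmod 2 = 2 - x"
  using assms rmod2_bounds[of u] unfolding fold_map_def by auto

lemma fold_map_uminus: "fold_map (- u) = fold_map u"
proof (cases "u rmod 2 = 0")
  case True
  then obtain n where "u = 2 * of_int n"
    using rmod2_decompose[of u] by auto
  then have "- u = 0 + 2 * of_int (- n)"
    by simp
  then have "(- u) rmod 2 = 0"
    using rmod2_eq_iff[of 0 "- u"] by (metis order_refl zero_less_numeral)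
  with True show ?thesis
    by (simp add: fold_map_def)
next
  case False
  then show ?thesis
    using rmod2_uminus[of u] by (auto simp: fold_map_def)
qed

lemma fold_map_add_2: "fold_map (u + 2) = fold_map u"
  by (simp add: fold_map_def rmod2_add_2)

subsection \<open>Feet of characteristics\<close>

text \<open>Undoing the reduction modulo 2 shows the preimage to lie in countably many
  differentiable images of the null cylinder over \<open>N\<close>.\<close>

lemma negligible_foot_vimage:
  assumes "negligible N"
  shows "negligible {p. foot c p \<in> N}"
proof -
  \<comment> \<open>Solves \<open>c * x - t = n + 2 * k\<close> for \<open>t\<close>: the sheet
    \<open>k\<close> of the preimage, parametrized by foot and position.\<close>
  let ?g = "\<lambda>k::int. \<lambda>(n, x). (c * x - n - 2 * of_int k, x) :: real \<times> real"
  have "N \<times> UNIV \<in> null_sets (lebesgue :: (real \<times> real) measure)"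
  proof -
    \<comment> \<open>\<open>N\<close> need not be Borel, while the product rule concerns
      \<open>lborel\<close>; hence the Borel null superset.\<close>
    obtain N' where N': "N \<subseteq> N'" "N' \<in> null_sets lborel"
      using assms by (auto simp: negligible_iff_null_sets null_sets_completion_iff2)
    have "N' \<times> UNIV \<in> null_sets (lborel :: (real \<times> real) measure)"
      using lborel.times_in_null_sets1[OF N'(2), of UNIV] by (simp add: lborel_prod)
    then show ?thesis
      using N'(1) by (auto simp: null_sets_completion_iff2 intro!: bexI[of _ "N' \<times> UNIV"])
  qed
  then have "negligible (N \<times> (UNIV :: real set))"
    by (simp add: negligible_iff_null_sets)
  moreover have "?g k differentiable_on S" for k S
    unfolding case_prod_beta differentiable_on_def
    by (intro ballI differentiableI[where f' = "\<lambda>h. (c * snd h - fst h, snd h)"])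
       (auto intro!: derivative_eq_intros)
  ultimately have "negligible (?g k ` (N \<times> UNIV))" for k
    by (intro negligible_differentiable_image_negligible) auto
  then have "negligible (\<Union>k. ?g k ` (N \<times> UNIV))"
    by (intro negligible_countable_Union) auto
  moreover have "{p. foot c p \<in> N} \<subseteq> (\<Union>k. ?g k ` (N \<times> UNIV))"
  proof
    fix p assume "p \<in> {p. foot c p \<in> N}"
    moreover obtain k where "c * snd p - fst p = foot c p + 2 * of_int k"
      using rmod2_decompose unfolding foot_def by blast
    ultimately have "p = ?g k (foot c p, snd p)" "(foot c p, snd p) \<in> N \<times> UNIV"
      by (auto simp: prod_eq_iff)
    then show "p \<in> (\<Union>k. ?g k ` (N \<times> UNIV))"
      by blast
  qed
  ultimately show ?thesis
    by (rule negligible_subset)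
qed

lemma negligible_corners: "negligible corners"
proof -
  have "corners = {p. foot 1 p \<in> {0, 1}} \<union> {p. foot (-1) p \<in> {0, 1}}"
    by (auto simp: corners_def)
  then show ?thesis
    using negligible_foot_vimage[OF negligible_finite, of "{0, 1}"] by (metis finite.intros negligible_Un)
qed

lemma foot_in_cover:
  assumes "p \<notin> corners"
  shows "foot 1 p \<in> cover" "foot (-1) p \<in> cover"
  using assms rmod2_bounds unfolding corners_def cover_def foot_def
  by (auto simp: less_le)

text \<open>Folding is even and 2-periodic, so a left-moving start at \<open>2 - a\<close> traces
  the same line as the torus motion \<open>a + t\<close>. An interior \<open>x\<close> has exactly
  the two unfoldings \<open>x\<close> and \<open>2 - x\<close>, which give the two feet.\<close>

lemma char_line_label:
  assumes "a \<in> cover" "0 < x" "x < 1"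
  shows "(t, x) \<in> char_line (label a) \<longleftrightarrow> t \<ge> 0 \<and> (a = foot 1 (t, x) \<or> a = foot (-1) (t, x))"
proof -
  have *: "fold_map (2 - a - s) = fold_map (a + s)" for s
    using fold_map_uminus[of "a + s"] fold_map_add_2[of "- (a + s)"] by (simp add: algebra_simps)
  have "(t, x) \<in> char_line (label a) \<longleftrightarrow> t \<ge> 0 \<and> fold_map (a + t) = x"
    by (auto simp: label_def *)
  moreover have "(a + t) rmod 2 = x \<longleftrightarrow> a = foot 1 (t, x)"
    using assms rmod2_add_eq_iff[of a x t] by (simp add: cover_def foot_def)
  moreover have "(a + t) rmod 2 = 2 - x \<longleftrightarrow> a = foot (-1) (t, x)"
    using assms rmod2_add_eq_iff[of a "2 - x" t] rmod2_add_2(1)[of "- x - t"]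
    by (simp add: cover_def foot_def algebra_simps)
  ultimately show ?thesis
    using fold_map_eq_iff[OF assms(2,3)] by blast
qed

text \<open>Modulo 2 the feet differ by \<open>2 * x\<close>, which lies strictly between 0 and
  2.\<close>

lemma foot_distinct:
  assumes "0 < x" "x < 1"
  shows "foot 1 (t, x) \<noteq> foot (-1) (t, x)"
proof
  assume "foot 1 (t, x) = foot (-1) (t, x)"
  then have "[x - t = - x - t] (rmod 2)"
    by (simp add: foot_def rcong_def)
  then have "[x = - x] (rmod 2)"
    by simp
  then show False
    using rcong_imp_eq[of x "- x" 2] assms by simp
qed

lemma inj_on_label: "inj_on label cover"
  by (auto simp: inj_on_def label_def split: if_splits)

text \<open>Only two characteristics pass through an interior point, so two distinct ones must be
  its two feet in some order. \<open>P\<close> and \<open>Q\<close> may overlap;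
  \<open>P = Q\<close> covers \<open>self_meet\<close>.\<close>

lemma cross_meet_label:
  assumes "P \<subseteq> cover" "Q \<subseteq> cover"
  shows "(t, x) \<in> cross_meet (label ` P) (label ` Q) \<longleftrightarrow> 0 \<le> t \<and> 0 < x \<and> x < 1 \<and>
    (foot 1 (t, x) \<in> P \<and> foot (-1) (t, x) \<in> Q \<or> foot (-1) (t, x) \<in> P \<and> foot 1 (t, x) \<in> Q)"
    (is "_ \<longleftrightarrow> ?R")
proof (cases "0 \<le> t \<and> 0 < x \<and> x < 1")
  case True
  have L: "label a \<noteq> label b \<longleftrightarrow> a \<noteq> b" if "a \<in> P" "b \<in> Q" for a b
    using that assms inj_on_label by (auto simp: inj_on_def)
  have C: "(t, x) \<in> char_line (label a) \<longleftrightarrow> a = foot 1 (t, x) \<or> a = foot (-1) (t, x)"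
    if "a \<in> cover" for a
    using char_line_label[OF that] True by auto
  have "(t, x) \<in> cross_meet (label ` P) (label ` Q) \<longleftrightarrow>
    (\<exists>a\<in>P. \<exists>b\<in>Q. label a \<noteq> label b \<and> (t, x) \<in> char_line (label a) \<and> (t, x) \<in> char_line (label b))"
    using True by (simp add: cross_meet_def)
  also have "\<dots> \<longleftrightarrow> (\<exists>a\<in>P. \<exists>b\<in>Q. a \<noteq> b \<and> (a = foot 1 (t, x) \<or> a = foot (-1) (t, x)) \<and>
      (b = foot 1 (t, x) \<or> b = foot (-1) (t, x)))"
    using assms by (intro bex_cong refl) (simp add: L C subset_iff)
  also have "\<dots> \<longleftrightarrow> ?R"
    using True foot_distinct[of x t] by metis
  finally show ?thesis .
qed (auto simp: cross_meet_def)

lemma self_meet_eq: "self_meet A = cross_meet A A"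
  by (simp add: self_meet_def cross_meet_def)

lemma space_double_cover: "space double_cover = unit_intvl \<times> UNIV"
  by (simp add: double_cover_def space_pair_measure)

lemma label_cover: "label ` cover = space double_cover"
proof
  show "label ` cover \<subseteq> space double_cover"
    by (auto simp: label_def cover_def space_double_cover)
  show "space double_cover \<subseteq> label ` cover"
  proof
    fix p assume "p \<in> space double_cover"
    then obtain x d where p: "p = (x, d)" "0 < x" "x < 1"
      by (auto simp: space_double_cover)
    show "p \<in> label ` cover"
    proof (cases d)
      case Xi
      then have "p = label x" "x \<in> cover" using p by (auto simp: label_def cover_def)
      then show ?thesis by blast
    next
      case Eta
      then have "p = label (2 - x)" "2 - x \<in> cover" using p by (auto simp: label_def cover_def)
      then show ?thesis by blast
    qed
  qed
qed

lemma space_minus_label: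
  "P \<subseteq> cover \<Longrightarrow> space double_cover - label ` P = label ` (cover - P)"
  using inj_on_image_set_diff[OF inj_on_label, of cover P] label_cover by simp

subsection \<open>Transfer of measurable sets to the torus\<close>

lemma flip_image_sets_lebesgue:
  fixes S :: "real set"
  assumes "S \<in> sets lebesgue"
  shows "(\<lambda>x. 2 - x) ` S \<in> sets lebesgue"
  using assms by (intro differentiable_image_in_sets_lebesgue) (auto intro!: derivative_intros)

lemma emeasure_flip_image: "emeasure lebesgue ((\<lambda>x. 2 - x) ` S) = emeasure lebesgue (S :: real set)"
  using emeasure_lebesgue_affine[of "-1" "2::real" S] by simp

lemma flip_image_iff: "x \<in> (\<lambda>x. 2 - x) ` S \<longleftrightarrow> 2 - x \<in> (S :: real set)"
  by force

text \<open>The part of \<open>P\<close> below 1 is the \<open>Xi\<close> slice, the part above 1 is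
  the mirrored \<open>Eta\<close> slice, and the mirror map preserves measure.\<close>

lemma label_image_double_cover:
  assumes "P \<subseteq> cover" "P \<in> sets lebesgue"
  shows "label ` P \<in> sets double_cover" "emeasure double_cover (label ` P) = emeasure lebesgue P"
proof -
  have xi: "{x. (x, Xi) \<in> label ` P} = P \<inter> {0<..<1}"
    using assms(1) by (force simp: label_def cover_def)
  have eta: "{x. (x, Eta) \<in> label ` P} = (\<lambda>x. 2 - x) ` (P \<inter> {1<..<2})"
    using assms(1) by (force simp: label_def cover_def)
  have m: "P \<inter> {0<..<1} \<in> sets lebesgue" "P \<inter> {1<..<2} \<in> sets lebesgue"
    using assms(2) by auto
  show D: "label ` P \<in> sets double_cover"
    unfolding sets_double_cover_iff
  proof
    fix d
    show "{x. (x, d) \<in> label ` P} \<subseteq> unit_intvl \<and> {x. (x, d) \<in> label ` P} \<in> sets lebesgue"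
      using m flip_image_sets_lebesgue[OF m(2)] by (cases d) (auto simp only: xi eta, auto)
  qed
  have "emeasure double_cover (label ` P) =
    emeasure lebesgue (P \<inter> {0<..<1}) + emeasure lebesgue (P \<inter> {1<..<2})"
    by (simp add: emeasure_double_cover[OF D] xi eta emeasure_flip_image)
  also have "\<dots> = emeasure lebesgue (P \<inter> {0<..<1} \<union> P \<inter> {1<..<2})"
    using m by (intro plus_emeasure) auto
  also have "P \<inter> {0<..<1} \<union> P \<inter> {1<..<2} = P"
    using assms(1) by (auto simp: cover_def)
  finally show "emeasure double_cover (label ` P) = emeasure lebesgue P" .
qed

lemma double_cover_setE:
  assumes "A \<in> sets double_cover"
  obtains P where "P \<subseteq> cover" "P \<in> sets lebesgue" "A = label ` P"
proof
  let ?P = "{x. (x, Xi) \<in> A} \<union> (\<lambda>x. 2 - x) ` {x. (x, Eta) \<in> A}"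
  have s: "{x. (x, d) \<in> A} \<subseteq> unit_intvl" "{x. (x, d) \<in> A} \<in> sets lebesgue" for d
    using assms by (auto simp: sets_double_cover_iff)
  show P: "?P \<subseteq> cover"
    using s(1)[of Xi] s(1)[of Eta] by (auto simp: cover_def)
  show "?P \<in> sets lebesgue"
    using s(2) flip_image_sets_lebesgue by auto
  have "A \<subseteq> space double_cover"
    using assms by (rule sets.sets_into_space)
  then have "A = label ` {a \<in> cover. label a \<in> A}"
    unfolding label_cover[symmetric] by blast
  also have "{a \<in> cover. label a \<in> A} = ?P"
    using P s(1)[of Xi] s(1)[of Eta]
    by (auto simp: label_def cover_def flip_image_iff split: if_splits)
  finally show "A = label ` ?P" .
qed

subsection \<open>The observability conditions as swap symmetry\<close>

text \<open>Off \<open>corners\<close>, a point is covered iff one foot is in \<open>P\<close> and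
  the other in \<open>Q\<close>, or both are in neither. For disjoint \<open>P\<close>,
  \<open>Q\<close> this is exactly that each foot is in \<open>P\<close> iff the other is in
  \<open>Q\<close>.\<close>

lemma obs_sym_N_iff_swap_sym:
  assumes "G \<subseteq> {0..T} \<times> unit_intvl" "P \<subseteq> cover" "Q \<subseteq> cover" "P \<inter> Q = {}"
  shows "obs_sym_N T (label ` P) (label ` Q) G \<longleftrightarrow> swap_sym G P Q"
proof -
  have PQ: "P \<union> Q \<subseteq> cover" and R: "cover - (P \<union> Q) \<subseteq> cover"
    using assms by auto
  let ?W = "up_to_time T (cross_meet (label ` P) (label ` Q)) \<union>
    up_to_time T (cross_meet (label ` (cover - (P \<union> Q))) (label ` (cover - (P \<union> Q))))"
  have W: "p \<notin> ?W \<longleftrightarrow> (foot 1 p \<in> P) \<noteq> (foot (-1) p \<in> Q) \<or> (foot (-1) p \<in> P) \<noteq> (foot 1 p \<in> Q)"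
    if "p \<in> G" "p \<notin> corners" for p
  proof -
    have "p \<in> {0..T} \<times> unit_intvl"
      using that(1) assms(1) by blast
    then obtain t x where p: "p = (t, x)" "0 \<le> t" "t \<le> T" "0 < x" "x < 1"
      by auto
    show ?thesis
      using foot_in_cover[OF that(2)] assms(4) p(2-)
      unfolding p(1) up_to_time_def Un_iff Int_iff cross_meet_label[OF assms(2,3)] cross_meet_label[OF R R]
      by simp blast
  qed
  show ?thesis
    unfolding obs_sym_N_def swap_sym_def negligible_iff_null_sets[symmetric]
      image_Un[symmetric] space_minus_label[OF PQ] self_meet_eq
    by (rule negligible_cong_mod[OF negligible_corners]) (use W in blast)+
qed

text \<open>A point is covered iff its feet are both in \<open>P\<close> or both outside; for equal
  sets the two clauses of \<open>swap_sym\<close> coincide.\<close>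

lemma obs_sym_D_iff_swap_sym:
  assumes "G \<subseteq> {0..T} \<times> unit_intvl" "P \<subseteq> cover"
  shows "obs_sym_D T (label ` P) G \<longleftrightarrow> swap_sym G P P"
proof -
  have R: "cover - P \<subseteq> cover"
    by auto
  let ?M = "up_to_time T (cross_meet (label ` P) (label ` P)) \<union>
    up_to_time T (cross_meet (label ` (cover - P)) (label ` (cover - P)))"
  have M: "p \<notin> ?M \<longleftrightarrow> (foot 1 p \<in> P) \<noteq> (foot (-1) p \<in> P)"
    if "p \<in> G" "p \<notin> corners" for p
  proof -
    have "p \<in> {0..T} \<times> unit_intvl"
      using that(1) assms(1) by blast
    then obtain t x where p: "p = (t, x)" "0 \<le> t" "t \<le> T" "0 < x" "x < 1"
      by auto
    show ?thesis
      using foot_in_cover[OF that(2)] p(2-)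
      unfolding p(1) up_to_time_def Un_iff Int_iff cross_meet_label[OF assms(2,2)] cross_meet_label[OF R R]
      by simp blast
  qed
  show ?thesis
    unfolding obs_sym_D_def swap_sym_def negligible_iff_null_sets[symmetric]
      space_minus_label[OF assms(2)] self_meet_eq
    by (rule negligible_cong_mod[OF negligible_corners]) (use M in blast)+
qed

lemma negligible_reflect_iff:
  "negligible ((\<lambda>p. (fst p, 2 - snd p)) ` S) \<longleftrightarrow> negligible (S :: (real \<times> real) set)"
proof -
  let ?r = "\<lambda>p::real \<times> real. (fst p, 2 - snd p)"
  have *: "negligible (?r ` X)" if "negligible X" for X
  proof (rule negligible_differentiable_image_negligible[OF order_refl that])
    show "?r differentiable_on X"
      unfolding differentiable_on_def
      by (intro ballI differentiableI[where f' = "\<lambda>h. (fst h, - snd h)"])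
         (auto intro!: derivative_eq_intros)
  qed
  have "?r ` ?r ` S = S"
    by (simp add: image_comp o_def)
  with *[of S] *[of "?r ` S"] show ?thesis
    by auto
qed

lemma foot_reflect:
  "foot 1 (t, 2 - x) = foot (-1) (t, x)" "foot (-1) (t, 2 - x) = foot 1 (t, x)"
  using rmod2_add_2(2)[of "- x - t"] rmod2_add_2(1)[of "x - t - 2"]
  by (simp_all add: foot_def algebra_simps)

text \<open>The fold lines \<open>s = 0\<close> and \<open>s = 1\<close> contribute nothing, because
  \<open>G\<close> lies over the open interval.\<close>

lemma reflected_eq:
  assumes "G \<subseteq> {0..T} \<times> unit_intvl"
  shows "reflected T G = G \<union> (\<lambda>p. (fst p, 2 - snd p)) ` G"
proof (intro set_eqI)
  fix q :: "real \<times> real"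
  obtain t s where q: "q = (t, s)"
    by (cases q)
  have im: "q \<in> (\<lambda>p. (fst p, 2 - snd p)) ` G \<longleftrightarrow> (t, 2 - s) \<in> G"
    unfolding q by force
  show "q \<in> reflected T G \<longleftrightarrow> q \<in> G \<union> (\<lambda>p. (fst p, 2 - snd p)) ` G"
    using assms fold_map_base[of s] unfolding Un_iff im
    by (auto simp: q reflected_def torus2_def split: if_splits)
qed

text \<open>The coordinate \<open>x - t\<close> is \<open>foot 1\<close> and \<open>x + t\<close> is
  the negative of \<open>foot (-1)\<close>, which is why \<open>A\<close> is mirrored. The copy of
  \<open>G\<close> gives one clause of swap symmetry; its mirror image, where the feet trade places,
  gives the other.\<close>

lemma obs_sym_T_iff_swap_sym:
  assumes "G \<subseteq> {0..T} \<times> unit_intvl"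
  shows "obs_sym_T T A B (reflected T G) \<longleftrightarrow> swap_sym G (cover \<inter> (\<lambda>x. 2 - x) ` A) (cover \<inter> B)"
proof -
  let ?P = "cover \<inter> (\<lambda>x. 2 - x) ` A" and ?Q = "cover \<inter> B"
  let ?r = "\<lambda>p::real \<times> real. (fst p, 2 - snd p)"
  let ?H = "reflected T G"
  let ?S1 = "{p \<in> G. (foot (-1) p \<in> ?P) \<noteq> (foot 1 p \<in> ?Q)}"
  let ?S2 = "{p \<in> G. (foot 1 p \<in> ?P) \<noteq> (foot (-1) p \<in> ?Q)}"
  let ?D = "sym_diff (?H \<inter> strip_xi T A) (?H \<inter> strip_eta T B)"
  let ?Y = "{q \<in> ?H. (foot (-1) q \<in> ?P) \<noteq> (foot 1 q \<in> ?Q)}"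
  have xi: "q \<in> strip_xi T A \<longleftrightarrow> foot (-1) q \<in> ?P" if "q \<in> ?H" "q \<notin> corners" for q
  proof -
    \<comment> \<open>Off \<open>corners\<close> negation modulo 2 really is \<open>2 - x\<close>;
      it fails only at foot 0.\<close>
    have "foot (-1) q \<noteq> 0"
      using that(2) by (auto simp: corners_def)
    then have "(snd q + fst q) rmod 2 = 2 - foot (-1) q"
      using rmod2_uminus[of "- snd q - fst q"] by (simp add: foot_def algebra_simps)
    moreover have "q \<in> {0..T} \<times> torus2"
      using that(1) by (auto simp: reflected_def)
    ultimately show ?thesis
      using foot_in_cover(2)[OF that(2)]
      by (auto simp: strip_xi_def case_prod_beta flip_image_iff)
  qed
  have eta: "q \<in> strip_eta T B \<longleftrightarrow> foot 1 q \<in> ?Q" if "q \<in> ?H" "q \<notin> corners" for q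
  proof -
    have "q \<in> {0..T} \<times> torus2"
      using that(1) by (auto simp: reflected_def)
    then show ?thesis
      using foot_in_cover(1)[OF that(2)]
      by (auto simp: strip_eta_def case_prod_beta foot_def)
  qed
  have "negligible ?D \<longleftrightarrow> negligible ?Y"
    by (rule negligible_cong_mod[OF negligible_corners]) (use xi eta in blast)+
  also have "?Y = ?S1 \<union> ?r ` ?S2"
    unfolding reflected_eq[OF assms] by (auto simp: foot_reflect image_iff)
  also have "negligible (?S1 \<union> ?r ` ?S2) \<longleftrightarrow> negligible ?S1 \<and> negligible ?S2"
    by (simp only: negligible_Un_eq negligible_reflect_iff)
  also have "\<dots> \<longleftrightarrow> negligible (?S1 \<union> ?S2)"
    by (simp only: negligible_Un_eq)
  also have "?S1 \<union> ?S2 = {p \<in> G. (foot 1 p \<in> ?P) \<noteq> (foot (-1) p \<in> ?Q) \<or>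
      (foot (-1) p \<in> ?P) \<noteq> (foot 1 p \<in> ?Q)}"
    by blast
  finally show ?thesis
    unfolding obs_sym_T_def swap_sym_def negligible_iff_null_sets .
qed

subsection \<open>Swap symmetric pairs\<close>

lemma swap_sym_commute: "swap_sym G A B \<longleftrightarrow> swap_sym G B A"
  unfolding swap_sym_def by (rule arg_cong[where f = negligible]) blast

text \<open>Passing from one foot to the other exchanges membership in \<open>A\<close> with
  membership in \<open>B\<close>. The resulting pair is disjoint, as (OSC-N) demands.\<close>

lemma swap_sym_Diff:
  assumes "swap_sym G A B"
  shows "swap_sym G (A - B) (B - A)"
  using assms unfolding swap_sym_def by (rule negligible_subset) blast

text \<open>Almost everywhere, a foot in \<open>A\<close> is in \<open>B\<close>, so the other foot
  is in \<open>A\<close>; and a foot in \<open>B\<close> forces the other into \<open>A\<close>,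
  hence into \<open>B\<close>.\<close>

lemma swap_sym_diag:
  assumes "swap_sym G A B" "negligible (A - B)"
  shows "swap_sym G A A" "swap_sym G B B"
proof -
  let ?X = "{p \<in> G. (foot 1 p \<in> A) \<noteq> (foot (-1) p \<in> B) \<or> (foot (-1) p \<in> A) \<noteq> (foot 1 p \<in> B)}"
  let ?N = "?X \<union> {p. foot 1 p \<in> A - B} \<union> {p. foot (-1) p \<in> A - B}"
  have N: "negligible ?N"
    using assms negligible_foot_vimage unfolding swap_sym_def by (intro negligible_Un)
  show "swap_sym G A A" "swap_sym G B B"
    unfolding swap_sym_def by (rule negligible_subset[OF N], blast)+
qed

text \<open>At almost every point of \<open>G\<close> the feet would avoid \<open>A\<close>, hence
  also \<open>B\<close>, although \<open>B\<close> is almost all of \<open>cover\<close>.\<close>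

lemma swap_sym_null_full:
  assumes "swap_sym G A B" "negligible A" "negligible (cover - B)"
  shows "negligible G"
proof -
  let ?X = "{p \<in> G. (foot 1 p \<in> A) \<noteq> (foot (-1) p \<in> B) \<or> (foot (-1) p \<in> A) \<noteq> (foot 1 p \<in> B)}"
  let ?N = "?X \<union> {p. foot 1 p \<in> A} \<union> {p. foot (-1) p \<in> cover - B} \<union> corners"
  have N: "negligible ?N"
    using assms negligible_foot_vimage negligible_corners unfolding swap_sym_def
    by (intro negligible_Un)
  show ?thesis
    by (rule negligible_subset[OF N]) (use foot_in_cover in blast)
qed

section \<open>Lebesgue measure on the cover\<close>

lemma cover_sets_lebesgue: "cover \<in> sets lebesgue"
  unfolding cover_def by auto

text \<open>The interval is closed at 2 because mirroring a subset of \<open>[0,2)\<close> may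
  produce the point 2.\<close>

lemma emeasure_cover_Int:
  assumes "S \<subseteq> {0..2}" "S \<in> sets lebesgue"
  shows "emeasure lebesgue (cover \<inter> S) = emeasure lebesgue S"
proof -
  have "cover \<inter> S = S - {0, 1, 2}"
    using assms(1) by (auto simp: cover_def)
  moreover have "{0, 1, 2} \<in> null_sets (lebesgue :: real measure)"
    by (simp flip: negligible_iff_null_sets)
  ultimately show ?thesis
    using emeasure_Diff_null_set assms(2) by metis
qed

lemma emeasure_cover: "emeasure lebesgue cover = 2"
  using emeasure_cover_Int[of "{0..2}"] by (simp add: cover_def Int_absorb2 subset_eq)

lemma negligible_cover_Diff:
  assumes "Q \<subseteq> cover" "Q \<in> sets lebesgue" "emeasure lebesgue Q = 2"
  shows "negligible (cover - Q)"
proof -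
  have "emeasure lebesgue (cover - Q) = emeasure lebesgue cover - emeasure lebesgue Q"
    by (rule emeasure_Diff) (use assms cover_sets_lebesgue in auto)
  then show ?thesis
    using assms cover_sets_lebesgue by (auto simp: negligible_iff_null_sets emeasure_cover)
qed

lemma negligible_iff_emeasure_0:
  "S \<in> sets lebesgue \<Longrightarrow> negligible S \<longleftrightarrow> emeasure lebesgue S = 0"
  by (auto simp: negligible_iff_null_sets)

section \<open>The three conditions as statements about swap symmetric subsets of the cover\<close>

lemma OSC_D_iff_swap_sym:
  assumes "G \<subseteq> {0..T} \<times> unit_intvl"
  shows "OSC_D T G \<longleftrightarrow> (\<forall>P. P \<subseteq> cover \<longrightarrow> P \<in> sets lebesgue \<longrightarrow> swap_sym G P P \<longrightarrow>
           emeasure lebesgue P = 0 \<or> emeasure lebesgue P = 2)" (is "_ \<longleftrightarrow> ?R")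
proof
  assume D: "OSC_D T G"
  show ?R
  proof (intro allI impI)
    fix P assume P: "P \<subseteq> cover" "P \<in> sets lebesgue" "swap_sym G P P"
    show "emeasure lebesgue P = 0 \<or> emeasure lebesgue P = 2"
      using D label_image_double_cover[OF P(1,2)] P(3) obs_sym_D_iff_swap_sym[OF assms P(1)]
      by (auto simp: OSC_D_def trivial_D_def)
  qed
next
  assume ?R
  then show "OSC_D T G"
    unfolding OSC_D_def trivial_D_def
    by (metis double_cover_setE label_image_double_cover(2) obs_sym_D_iff_swap_sym[OF assms])
qed

lemma OSC_N_iff_swap_sym:
  assumes "G \<subseteq> {0..T} \<times> unit_intvl"
  shows "OSC_N T G \<longleftrightarrow> (\<forall>P Q. P \<subseteq> cover \<longrightarrow> P \<in> sets lebesgue \<longrightarrow> Q \<subseteq> cover \<longrightarrow> Q \<in> sets lebesgue \<longrightarrow>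
           P \<inter> Q = {} \<longrightarrow> swap_sym G P Q \<longrightarrow>
           emeasure lebesgue P = 0 \<or> emeasure lebesgue Q = 0)" (is "_ \<longleftrightarrow> ?R")
proof
  assume N: "OSC_N T G"
  show ?R
  proof (intro allI impI)
    fix P Q assume P: "P \<subseteq> cover" "P \<in> sets lebesgue" and Q: "Q \<subseteq> cover" "Q \<in> sets lebesgue"
      and PQ: "P \<inter> Q = {}" "swap_sym G P Q"
    have "label ` P \<inter> label ` Q = {}"
      using inj_on_image_Int[OF inj_on_label P(1) Q(1)] PQ(1) by simp
    with N have "trivial_N (label ` P) (label ` Q)"
      using label_image_double_cover(1)[OF P] label_image_double_cover(1)[OF Q] PQ(2)
        obs_sym_N_iff_swap_sym[OF assms P(1) Q(1) PQ(1)]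
      unfolding OSC_N_def by blast
    then show "emeasure lebesgue P = 0 \<or> emeasure lebesgue Q = 0"
      using label_image_double_cover(2)[OF P] label_image_double_cover(2)[OF Q]
      by (simp add: trivial_N_def)
  qed
next
  assume R: ?R
  show "OSC_N T G"
    unfolding OSC_N_def
  proof (intro ballI impI notI)
    fix E F
    assume EF: "E \<in> sets double_cover" "F \<in> sets double_cover" "E \<inter> F = {}" "\<not> trivial_N E F"
      "obs_sym_N T E F G"
    obtain P where P: "P \<subseteq> cover" "P \<in> sets lebesgue" "E = label ` P"
      using EF(1) by (rule double_cover_setE)
    obtain Q where Q: "Q \<subseteq> cover" "Q \<in> sets lebesgue" "F = label ` Q"
      using EF(2) by (rule double_cover_setE)
    have "P \<inter> Q = {}"
      using EF(3) P(3) Q(3) by blast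
    then show False
      using R P Q EF(4,5) obs_sym_N_iff_swap_sym[OF assms P(1) Q(1)]
        label_image_double_cover(2)[OF P(1,2)] label_image_double_cover(2)[OF Q(1,2)]
      by (auto simp: trivial_N_def)
  qed
qed

lemma OSC_T_iff_swap_sym:
  assumes "G \<subseteq> {0..T} \<times> unit_intvl"
  shows "OSC_T T (reflected T G) \<longleftrightarrow>
    (\<forall>P Q. P \<subseteq> cover \<longrightarrow> P \<in> sets lebesgue \<longrightarrow> Q \<subseteq> cover \<longrightarrow> Q \<in> sets lebesgue \<longrightarrow>
       swap_sym G P Q \<longrightarrow> trivial_T P Q)" (is "_ \<longleftrightarrow> ?R")
proof
  assume T: "OSC_T T (reflected T G)"
  show ?R
  proof (intro allI impI)
    fix P Q assume P: "P \<subseteq> cover" "P \<in> sets lebesgue" and Q: "Q \<subseteq> cover" "Q \<in> sets lebesgue"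
      and PQ: "swap_sym G P Q"
    \<comment> \<open>Mirroring is an involution, so this set is sent back to \<open>P\<close>; it
      stays inside the torus because 0 is not in \<open>P\<close>.\<close>
    let ?A = "(\<lambda>x. 2 - x) ` P"
    have "?A \<in> sets (lebesgue_on torus2)" "Q \<in> sets (lebesgue_on torus2)"
      using P Q flip_image_sets_lebesgue[OF P(2)]
      by (auto simp: sets_restrict_space_iff torus2_def cover_def)
    moreover have "cover \<inter> (\<lambda>x. 2 - x) ` ?A = P" "cover \<inter> Q = Q"
      using P(1) Q(1) by (auto simp: image_comp o_def)
    then have "obs_sym_T T ?A Q (reflected T G)"
      using PQ obs_sym_T_iff_swap_sym[OF assms] by simp
    ultimately have "trivial_T ?A Q"
      using T unfolding OSC_T_def by blast
    then show "trivial_T P Q"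
      by (simp add: trivial_T_def emeasure_flip_image)
  qed
next
  assume R: ?R
  show "OSC_T T (reflected T G)"
    unfolding OSC_T_def
  proof (intro ballI impI notI)
    fix A B
    assume AB: "A \<in> sets (lebesgue_on torus2)" "B \<in> sets (lebesgue_on torus2)"
      "\<not> trivial_T A B" "obs_sym_T T A B (reflected T G)"
    let ?P = "cover \<inter> (\<lambda>x. 2 - x) ` A" and ?Q = "cover \<inter> B"
    have A: "A \<subseteq> {0..<2}" "A \<in> sets lebesgue" and B: "B \<subseteq> {0..<2}" "B \<in> sets lebesgue"
      using AB(1,2) by (simp_all add: sets_restrict_space_iff torus2_def)
    have "(\<lambda>x. 2 - x) ` A \<subseteq> {0..2}" "B \<subseteq> {0..2}"
      using A(1) B(1) by (auto dest: subsetD)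
    then have "emeasure lebesgue ?P = emeasure lebesgue A" "emeasure lebesgue ?Q = emeasure lebesgue B"
      using A(2) B(2) flip_image_sets_lebesgue by (simp_all add: emeasure_cover_Int emeasure_flip_image)
    moreover have "trivial_T ?P ?Q"
      by (rule R[rule_format])
         (use A(2) B(2) AB(4) flip_image_sets_lebesgue cover_sets_lebesgue obs_sym_T_iff_swap_sym[OF assms]
          in auto)
    ultimately show False
      using AB(3) by (simp add: trivial_T_def)
  qed
qed

section \<open>The equivalence, by comparing measures of swap symmetric pairs\<close>

theorem proposition4p4:
  fixes T :: real and G :: "(real \<times> real) set"
  assumes "T > 0"
    and "G \<subseteq> {0..T} \<times> unit_intvl"
    and "G \<in> sets lebesgue"
  shows "OSC_T T (reflected T G) \<longleftrightarrow> OSC_D T G \<and> OSC_N T G"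
  unfolding OSC_T_iff_swap_sym[OF assms(2)] OSC_D_iff_swap_sym[OF assms(2)]
    OSC_N_iff_swap_sym[OF assms(2)]
proof (intro iffI conjI allI impI)
  fix P Q :: "real set"
  assume T: "\<forall>P Q. P \<subseteq> cover \<longrightarrow> P \<in> sets lebesgue \<longrightarrow> Q \<subseteq> cover \<longrightarrow> Q \<in> sets lebesgue \<longrightarrow>
      swap_sym G P Q \<longrightarrow> trivial_T P Q"
    and PQ: "P \<subseteq> cover" "P \<in> sets lebesgue" "Q \<subseteq> cover" "Q \<in> sets lebesgue" "P \<inter> Q = {}"
      "swap_sym G P Q"
  \<comment> \<open>For a disjoint pair only the null alternative of \<open>trivial_T\<close> can
    occur: two disjoint full sets would have total measure 4 inside \<open>cover\<close>, of measure
    2.\<close>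
  have "\<not> (emeasure lebesgue P = 2 \<and> emeasure lebesgue Q = 2)"
  proof
    assume "emeasure lebesgue P = 2 \<and> emeasure lebesgue Q = 2"
    then have "emeasure lebesgue (P \<union> Q) = 2 + 2"
      using plus_emeasure[of P lebesgue Q] PQ by simp
    moreover have "emeasure lebesgue (P \<union> Q) \<le> 2"
      using emeasure_mono[of "P \<union> Q" cover lebesgue] PQ cover_sets_lebesgue emeasure_cover by simp
    ultimately show False
      by simp
  qed
  with T PQ show "emeasure lebesgue P = 0 \<or> emeasure lebesgue Q = 0"
    by (auto simp: trivial_T_def)
next
  fix P :: "real set"
  assume "\<forall>P Q. P \<subseteq> cover \<longrightarrow> P \<in> sets lebesgue \<longrightarrow> Q \<subseteq> cover \<longrightarrow> Q \<in> sets lebesgue \<longrightarrow>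
      swap_sym G P Q \<longrightarrow> trivial_T P Q"
    and "P \<subseteq> cover" "P \<in> sets lebesgue" "swap_sym G P P"
  then show "emeasure lebesgue P = 0 \<or> emeasure lebesgue P = 2"
    by (auto simp: trivial_T_def)
next
  fix P Q :: "real set"
  assume DN: "(\<forall>P. P \<subseteq> cover \<longrightarrow> P \<in> sets lebesgue \<longrightarrow> swap_sym G P P \<longrightarrow>
        emeasure lebesgue P = 0 \<or> emeasure lebesgue P = 2) \<and>
      (\<forall>P Q. P \<subseteq> cover \<longrightarrow> P \<in> sets lebesgue \<longrightarrow> Q \<subseteq> cover \<longrightarrow> Q \<in> sets lebesgue \<longrightarrow>
        P \<inter> Q = {} \<longrightarrow> swap_sym G P Q \<longrightarrow> emeasure lebesgue P = 0 \<or> emeasure lebesgue Q = 0)"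
    and P: "P \<subseteq> cover" "P \<in> sets lebesgue" and Q: "Q \<subseteq> cover" "Q \<in> sets lebesgue"
    and PQ: "swap_sym G P Q"
  \<comment> \<open>(OSC-N) is applied to the two differences, which form a disjoint swap symmetric
    pair.\<close>
  have "emeasure lebesgue (P - Q) = 0 \<or> emeasure lebesgue (Q - P) = 0"
    by (rule DN[THEN conjunct2, rule_format]) (use P Q swap_sym_Diff[OF PQ] in auto)
  \<comment> \<open>If it is \<open>Q - P\<close> that is null, the roles of \<open>P\<close> and
    \<open>Q\<close> are exchanged.\<close>
  then have "swap_sym G P P" "swap_sym G Q Q"
    using P(2) Q(2) PQ swap_sym_diag swap_sym_commute
    by (metis negligible_iff_emeasure_0 sets.Diff)+
  with DN P Q have vals: "emeasure lebesgue P = 0 \<or> emeasure lebesgue P = 2"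
    "emeasure lebesgue Q = 0 \<or> emeasure lebesgue Q = 2"
    by blast+
  \<comment> \<open>On a null \<open>G\<close> every pair is swap symmetric; a set of measure 1,
    neither null nor full, then contradicts (OSC-D).\<close>
  have "\<not> negligible G"
  proof
    assume "negligible G"
    then have "swap_sym G {0<..<1} {0<..<1}"
      unfolding swap_sym_def by (rule negligible_subset) auto
    moreover have "{0<..<1} \<subseteq> cover"
      by (auto simp: cover_def)
    ultimately have "emeasure lebesgue {0<..<1::real} = 0 \<or> emeasure lebesgue {0<..<1::real} = 2"
      by (intro DN[THEN conjunct1, rule_format]) auto
    then show False
      by simp
  qed
  \<comment> \<open>One null and one full set would make \<open>G\<close> null; the second case
    follows by commuting the pair.\<close>
  then have "\<not> (emeasure lebesgue P = 0 \<and> emeasure lebesgue Q = 2)"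
    "\<not> (emeasure lebesgue P = 2 \<and> emeasure lebesgue Q = 0)"
    using P Q PQ swap_sym_null_full negligible_cover_Diff negligible_iff_emeasure_0 swap_sym_commute
    by metis+
  with vals show "trivial_T P Q"
    by (auto simp: trivial_T_def)
qed

end
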